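(* Let $\Omega\subset\mathbb{R}^n$ be a bounded measurable set with $|\Omega|=1$, and let $a,d,\kappa_0>0$. Let $\Omega=\Omega_1\cup\Omega_2$ be a decomposition into disjoint measurable sets with $|\Omega_1|>0$. Assume $a>d$ and $$\kappa_0^2>4\Big(\frac{d}{a-d}\Big)^2|\Omega_1|.$$ Then nonnegative stationary solutions $(U,\bar\xi)\in L^\infty(\Omega)\times\mathbb{R}$ of the nonlocal system $$u_t=\Big(\frac{au\xi}{1+u\xi}-d\Big)u\quad(x\in\Omega,\ t>0),\qquad \xi_t=-\xi-\xi\int_\Omega u^2\,dx+\kappa_0\quad(t>0)$$ with $U\neq0$ on $\Omega_1$ and $U=0$ on $\Omega_2$ exist, and they are given by $$U(x)=\begin{cases}\dfrac{d}{(a-d)\bar\xi}&\text{if }x\in\Omega_1,\\[2mm]0&\text{if }x\in\Omega_2,\end{cases}$$ where $\bar\xi$ satisfies $$\bar\xi^2-\kappa_0\bar\xi+\frac{d^2}{(a-d)^2}|\Omega_1|=0 .$$ Moreover, every such couple $(U,\bar\xi)$ is an unstable solution (in the Lyapunov sense) of the initial value problem for this nonlocal system.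
   Context: A stationary solution is a couple $(U,\bar\xi)\in L^\infty(\Omega)\times\mathbb{R}$ such that $\big(\frac{aU\bar\xi}{1+U\bar\xi}-d\big)U=0$ a.e. in $\Omega$ and $-\bar\xi-\bar\xi\int_\Omega U^2\,dx+\kappa_0=0$. Functions on $\Omega$ are identified when equal a.e. Stability is understood in the Banach space $X=L^\infty(\Omega)\times\mathbb{R}$ with norm $\|(w,\eta)\|_X=\|w\|_{L^\infty(\Omega)}+|\eta|$. For initial data $(u_0,\xi_0)\in X$ (close to $(U,\bar\xi)$) the system has a unique local-in-time solution in $C([0,T],L^\infty(\Omega))\times C([0,T])$ (in the integrated-in-time sense), extended to its maximal existence interval. The stationary solution $(U,\bar\xi)$ is Lyapunov stable if for every $\varepsilon>0$ there is $\delta>0$ such that $\|(u_0-U,\xi_0-\bar\xi)\|_X<\delta$ implies that the solution exists for all $t\ge0$ and $\|(u(t)-U,\xi(t)-\bar\xi)\|_X<\varepsilon$ for all $t\ge0$; it is unstable if it is not Lyapunov stable. *)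

theory Defs
  imports "HOL-Analysis.Analysis" "HOL-Probability.Essential_Supremum"
begin

text \<open>
  Elements of L-infinity are represented by functions; everything below depends only on their
  classes modulo a.e. equality. The norm takes values in the extended reals and is infinite
  for functions that are not measurable or not essentially bounded.
\<close>

definition linf_norm :: "'a measure \<Rightarrow> ('a \<Rightarrow> real) \<Rightarrow> ereal" where
  "linf_norm M f = esssup M (\<lambda>x. ereal \<bar>f x\<bar>)"

definition Linf :: "'a measure \<Rightarrow> ('a \<Rightarrow> real) set" where
  "Linf M = {f \<in> borel_measurable M. linf_norm M f < \<infinity>}"

definition X_norm :: "'a measure \<Rightarrow> ('a \<Rightarrow> real) \<Rightarrow> real \<Rightarrow> ereal" where
  "X_norm M w \<eta> = linf_norm M w + ereal \<bar>\<eta>\<bar>"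

definition linf_continuous_on :: "'a measure \<Rightarrow> real set \<Rightarrow> (real \<Rightarrow> 'a \<Rightarrow> real) \<Rightarrow> bool" where
  "linf_continuous_on M J u \<longleftrightarrow>
     (\<forall>t\<in>J. u t \<in> Linf M) \<and>
     (\<forall>t\<in>J. ((\<lambda>s. linf_norm M (\<lambda>x. u s x - u t x)) \<longlongrightarrow> 0) (at t within J))"

text \<open>
  The integral over a time interval of an L-infinity valued function: the definition of
  \<^term>\<open>(has_integral)\<close> with the norm replaced by the L-infinity norm. For norm-continuous
  integrands this is the usual Riemann (or Bochner) integral in L-infinity.
\<close>

definition linf_has_integral ::
    "'a measure \<Rightarrow> (real \<Rightarrow> 'a \<Rightarrow> real) \<Rightarrow> ('a \<Rightarrow> real) \<Rightarrow> real \<Rightarrow> real \<Rightarrow> bool" where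
  "linf_has_integral M g I s t \<longleftrightarrow>
     (\<forall>r\<in>{s..t}. g r \<in> Linf M) \<and> I \<in> Linf M \<and>
     (\<forall>e>0. \<exists>\<gamma>. gauge \<gamma> \<and>
        (\<forall>D. D tagged_division_of {s..t} \<and> \<gamma> fine D \<longrightarrow>
           linf_norm M (\<lambda>x. (\<Sum>(r, K)\<in>D. measure lborel K * g r x) - I x) < ereal e))"

definition u_rhs :: "real \<Rightarrow> real \<Rightarrow> real \<Rightarrow> real \<Rightarrow> real" where
  "u_rhs a d w z = (a * w * z / (1 + w * z) - d) * w"

definition xi_rhs :: "'a measure \<Rightarrow> real \<Rightarrow> ('a \<Rightarrow> real) \<Rightarrow> real \<Rightarrow> real" where
  "xi_rhs M \<kappa>\<^sub>0 w z = - z - z * (LINT x|M. (w x)\<^sup>2) + \<kappa>\<^sub>0"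

text \<open>
  No condition \<^prop>\<open>1 + U x * \<xi> \<noteq> (0::real)\<close> is needed here: at a point where it fails, the
  convention \<^prop>\<open>y / 0 = (0::real)\<close> turns the first equation into \<^prop>\<open>- d * U x = (0::real)\<close>,
  which for nonzero \<^term>\<open>d\<close> contradicts the failure.
\<close>

definition stationary_solution ::
    "'a measure \<Rightarrow> real \<Rightarrow> real \<Rightarrow> real \<Rightarrow> ('a \<Rightarrow> real) \<Rightarrow> real \<Rightarrow> bool" where
  "stationary_solution M a d \<kappa>\<^sub>0 U \<xi> \<longleftrightarrow>
     U \<in> Linf M \<and> (AE x in M. u_rhs a d (U x) \<xi> = 0) \<and> xi_rhs M \<kappa>\<^sub>0 U \<xi> = 0"

text \<open>
  Solutions on \<^term>\<open>{0..T}\<close> in the integrated-in-time sense. Taking \<^prop>\<open>t = (0::real)\<close> in the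
  integral equations yields the initial conditions. The denominator of the nonlinearity has to
  be nonzero a.e.; together with the boundedness of the integrand required by
  \<^const>\<open>linf_has_integral\<close> this excludes any use of division by zero.
\<close>

definition solution_on ::
    "'a measure \<Rightarrow> real \<Rightarrow> real \<Rightarrow> real \<Rightarrow> ('a \<Rightarrow> real) \<Rightarrow> real \<Rightarrow> real \<Rightarrow>
     (real \<Rightarrow> 'a \<Rightarrow> real) \<Rightarrow> (real \<Rightarrow> real) \<Rightarrow> bool" where
  "solution_on M a d \<kappa>\<^sub>0 u\<^sub>0 \<xi>\<^sub>0 T u \<xi> \<longleftrightarrow>
     linf_continuous_on M {0..T} u \<and> continuous_on {0..T} \<xi> \<and>
     (\<forall>t\<in>{0..T}. AE x in M. 1 + u t x * \<xi> t \<noteq> 0) \<and>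
     (\<forall>t\<in>{0..T}.
        linf_has_integral M (\<lambda>s x. u_rhs a d (u s x) (\<xi> s)) (\<lambda>x. u t x - u\<^sub>0 x) 0 t \<and>
        ((\<lambda>s. xi_rhs M \<kappa>\<^sub>0 (u s) (\<xi> s)) has_integral (\<xi> t - \<xi>\<^sub>0)) {0..t})"

definition global_solution ::
    "'a measure \<Rightarrow> real \<Rightarrow> real \<Rightarrow> real \<Rightarrow> ('a \<Rightarrow> real) \<Rightarrow> real \<Rightarrow>
     (real \<Rightarrow> 'a \<Rightarrow> real) \<Rightarrow> (real \<Rightarrow> real) \<Rightarrow> bool" where
  "global_solution M a d \<kappa>\<^sub>0 u\<^sub>0 \<xi>\<^sub>0 u \<xi> \<longleftrightarrow> (\<forall>T>0. solution_on M a d \<kappa>\<^sub>0 u\<^sub>0 \<xi>\<^sub>0 T u \<xi>)"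

text \<open>
  Solutions are unique (up to a.e. equality) for given initial data, so the existential
  quantifier over the global solution speaks about the solution of the initial value problem.
\<close>

definition lyapunov_stable ::
    "'a measure \<Rightarrow> real \<Rightarrow> real \<Rightarrow> real \<Rightarrow> ('a \<Rightarrow> real) \<Rightarrow> real \<Rightarrow> bool" where
  "lyapunov_stable M a d \<kappa>\<^sub>0 U \<xi>' \<longleftrightarrow>
     (\<forall>\<epsilon>>0. \<exists>\<delta>>0. \<forall>u\<^sub>0\<in>Linf M. \<forall>\<xi>\<^sub>0.
        X_norm M (\<lambda>x. u\<^sub>0 x - U x) (\<xi>\<^sub>0 - \<xi>') < ereal \<delta> \<longrightarrow>
        (\<exists>u \<xi>. global_solution M a d \<kappa>\<^sub>0 u\<^sub>0 \<xi>\<^sub>0 u \<xi> \<and>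
           (\<forall>t\<ge>0. X_norm M (\<lambda>x. u t x - U x) (\<xi> t - \<xi>') < ereal \<epsilon>)))"

definition unstable ::
    "'a measure \<Rightarrow> real \<Rightarrow> real \<Rightarrow> real \<Rightarrow> ('a \<Rightarrow> real) \<Rightarrow> real \<Rightarrow> bool" where
  "unstable M a d \<kappa>\<^sub>0 U \<xi> \<longleftrightarrow> \<not> lyapunov_stable M a d \<kappa>\<^sub>0 U \<xi>"

definition nonneg_stationary_with_support ::
    "'a set \<Rightarrow> 'a set \<Rightarrow> 'a measure \<Rightarrow> real \<Rightarrow> real \<Rightarrow> real \<Rightarrow> ('a \<Rightarrow> real) \<Rightarrow> real \<Rightarrow> bool" where
  "nonneg_stationary_with_support \<Omega>\<^sub>1 \<Omega>\<^sub>2 M a d \<kappa>\<^sub>0 U \<xi> \<longleftrightarrow>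
     stationary_solution M a d \<kappa>\<^sub>0 U \<xi> \<and>
     (AE x in M. 0 \<le> U x) \<and> 0 \<le> \<xi> \<and>
     (AE x in M. x \<in> \<Omega>\<^sub>1 \<longrightarrow> U x \<noteq> 0) \<and> (AE x in M. x \<in> \<Omega>\<^sub>2 \<longrightarrow> U x = 0)"

end

theory Submission
  imports Defs
begin

text \<open>
  On \<open>\<Omega>\<^sub>1\<close> a nonnegative stationary \<open>U\<close> is constant. Perturb it by a small constant on one of two
  disjoint nonnull parts \<open>A\<close>, \<open>B\<close> of \<open>\<Omega>\<^sub>1\<close>. For \<open>x \<in> A\<close>, \<open>y \<in> B\<close> the values \<open>u(t, x)\<close> and
  \<open>u(t, y)\<close> solve the same scalar equation, whose right-hand side has slope close to
  \<open>d (a - d) / a > 0\<close> near \<open>U\<close>. So their difference keeps growing while the solution is near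
  \<open>(U, \<xi>)\<close>, and the solution has to leave a fixed neighbourhood. The equation for \<open>\<xi>\<close> and the
  existence theory for the initial value problem play no role.
\<close>

section \<open>The essential supremum norm and membership in L-infinity\<close>

lemma AE_linf_norm_less:
  assumes "linf_norm M f < ereal e"
  shows "AE x in M. \<bar>f x\<bar> < e"
  using esssup_AE[where M = M and f = "\<lambda>x. ereal \<bar>f x\<bar>"]
proof eventually_elim
  case (elim x)
  then have "ereal \<bar>f x\<bar> < ereal e"
    using assms unfolding linf_norm_def by (rule le_less_trans)
  then show ?case by simp
qed

lemma AE_X_norm_less:
  assumes "X_norm M w \<eta> < ereal e"
  shows "AE x in M. \<bar>w x\<bar> + \<bar>\<eta>\<bar> < e"
proof -
  have "linf_norm M w < ereal (e - \<bar>\<eta>\<bar>)"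
    using assms unfolding X_norm_def by (cases "linf_norm M w") auto
  from AE_linf_norm_less[OF this] show ?thesis
    by eventually_elim simp
qed

lemma linf_norm_le:
  assumes "f \<in> borel_measurable M" "AE x in M. \<bar>f x\<bar> \<le> c"
  shows "linf_norm M f \<le> ereal c"
  unfolding linf_norm_def by (rule esssup_I) (use assms in auto)

lemma LinfI:
  assumes "f \<in> borel_measurable M" "AE x in M. \<bar>f x\<bar> \<le> c"
  shows "f \<in> Linf M"
  using linf_norm_le[OF assms] assms(1) unfolding Linf_def
  by (auto intro: le_less_trans)

lemma LinfE:
  assumes "f \<in> Linf M"
  obtains c where "f \<in> borel_measurable M" "AE x in M. \<bar>f x\<bar> \<le> c"
proof -
  have f: "f \<in> borel_measurable M" and "linf_norm M f < \<infinity>"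
    using assms by (auto simp: Linf_def)
  then obtain c where c: "linf_norm M f < ereal c"
    by (meson ereal_dense2)
  show thesis
    by (rule that[of c]) (use f AE_linf_norm_less[OF c] in \<open>auto elim: eventually_mono\<close>)
qed

section \<open>Riemann sums and increments of L-infinity valued integrals\<close>

text \<open>The bound \<open>m\<close> is asked for at the tags only. These are finitely many, so
  for integrands known only almost everywhere a single null set covers them all. Upper bounds come
  from applying this to \<open>- v\<close>.\<close>

lemma Riemann_sum_ge:
  fixes s t :: real
  assumes D: "D tagged_division_of {s..t}" and "s \<le> t" and m: "\<And>r. r \<in> fst ` D \<Longrightarrow> m \<le> v r"
  shows "m * (t - s) \<le> (\<Sum>(r, K)\<in>D. measure lborel K * v r)"
proof -
  have "(\<Sum>(r, K)\<in>D. measure lborel K) = t - s"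
    using additive_content_tagged_division[of D s t] assms by simp
  then have "m * (t - s) = (\<Sum>(r, K)\<in>D. measure lborel K * m)"
    by (simp add: sum_distrib_right[symmetric] case_prod_unfold mult.commute[of m])
  also have "\<dots> \<le> (\<Sum>(r, K)\<in>D. measure lborel K * v r)"
    by (rule sum_mono) (force intro!: mult_left_mono m)
  finally show ?thesis .
qed

text \<open>A division of \<open>{r..s}\<close> followed by one of \<open>{s..t}\<close> divides
  \<open>{r..t}\<close>, so the sum over the second part is a difference of two sums, one within
  \<open>e / 2\<close> of \<open>J\<close> and one within \<open>e / 2\<close> of \<open>I\<close>.
  A single division is returned: it evaluates \<open>g\<close> at finitely many times only, which
  keeps the exceptional sets null.\<close>

lemma linf_has_integral_increment:
  fixes r s t :: real
  assumes I: "linf_has_integral M g I r s" and J: "linf_has_integral M g J r t"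
    and "r \<le> s" "s \<le> t" "e > 0"
  obtains D where "D tagged_division_of {s..t}"
    "AE x in M. \<bar>(\<Sum>(q, K)\<in>D. measure lborel K * g q x) - (J x - I x)\<bar> < e"
proof -
  obtain \<gamma>1 where \<gamma>1: "gauge \<gamma>1" and I': "\<And>D. D tagged_division_of {r..s} \<Longrightarrow> \<gamma>1 fine D \<Longrightarrow>
      linf_norm M (\<lambda>x. (\<Sum>(q, K)\<in>D. measure lborel K * g q x) - I x) < ereal (e/2)"
    using I \<open>e > 0\<close> unfolding linf_has_integral_def by (meson half_gt_zero)
  obtain \<gamma>2 where \<gamma>2: "gauge \<gamma>2" and J': "\<And>D. D tagged_division_of {r..t} \<Longrightarrow> \<gamma>2 fine D \<Longrightarrow>
      linf_norm M (\<lambda>x. (\<Sum>(q, K)\<in>D. measure lborel K * g q x) - J x) < ereal (e/2)"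
    using J \<open>e > 0\<close> unfolding linf_has_integral_def by (meson half_gt_zero)
  \<comment> \<open>\<open>D1\<close> is used twice, alone against \<open>I\<close> and inside
    \<open>D1 \<union> D2\<close> against \<open>J\<close>, hence it has to be fine for both
    gauges.\<close>
  obtain D1 where D1: "D1 tagged_division_of {r..s}" "(\<lambda>x. \<gamma>1 x \<inter> \<gamma>2 x) fine D1"
    using fine_division_exists_real[OF gauge_Int[OF \<gamma>1 \<gamma>2]] by blast
  obtain D2 where D2: "D2 tagged_division_of {s..t}" "\<gamma>2 fine D2"
    using fine_division_exists_real[OF \<gamma>2] by blast
  have "{r..s} \<union> {s..t} = {r..t}"
    using assms by auto
  then have D: "D1 \<union> D2 tagged_division_of {r..t}"
    using tagged_division_Un[OF D1(1) D2(1)] by (auto simp: interior_atLeastAtMost_real)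
  have fine: "\<gamma>1 fine D1" "\<gamma>2 fine D1 \<union> D2"
    using D1(2) D2(2) by (simp_all add: fine_Int fine_Un)
  \<comment> \<open>The two divisions need not be disjoint as sets: both may contain a degenerate
    interval at \<open>s\<close>. Such common elements have length 0, so the sum over the union
    still splits.\<close>
  have zero: "measure lborel K * g q x = 0" if in1: "(q, K) \<in> D1" and in2: "(q, K) \<in> D2" for q K x
  proof -
    obtain b c where K: "K = {b..c}"
      using tagged_division_ofD(4)[OF D1(1) in1] unfolding box_real by blast
    have "K \<subseteq> {r..s}" "K \<subseteq> {s..t}"
      by (rule tagged_division_ofD(3)[OF D1(1) in1], rule tagged_division_ofD(3)[OF D2(1) in2])
    then have "c \<le> b" using K by auto
    then show ?thesis using K by simp
  qed
  have split: "(\<Sum>(q, K)\<in>D1 \<union> D2. measure lborel K * g q x) =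
      (\<Sum>(q, K)\<in>D1. measure lborel K * g q x) + (\<Sum>(q, K)\<in>D2. measure lborel K * g q x)" for x
    by (rule sum.union_inter_neutral) (use D1 D2 zero in auto)
  have "AE x in M. \<bar>(\<Sum>(q, K)\<in>D2. measure lborel K * g q x) - (J x - I x)\<bar> < e"
    using AE_linf_norm_less[OF I'[OF D1(1) fine(1)]] AE_linf_norm_less[OF J'[OF D fine(2)]]
    unfolding split by eventually_elim linarith
  then show thesis using that D2(1) by blast
qed

text \<open>Every Riemann sum over a single point vanishes. This turns the integral equation at time
  0 into the initial condition, up to an arbitrarily small error.\<close>

lemma linf_has_integral_degenerate:
  fixes s :: real
  assumes "linf_has_integral M g I s s" "e > 0"
  shows "AE x in M. \<bar>I x\<bar> < e"
proof -
  obtain \<gamma> where "gauge \<gamma>" and I: "\<And>D. D tagged_division_of {s..s} \<Longrightarrow> \<gamma> fine D \<Longrightarrow>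
      linf_norm M (\<lambda>x. (\<Sum>(q, K)\<in>D. measure lborel K * g q x) - I x) < ereal e"
    using assms unfolding linf_has_integral_def by meson
  then obtain D where D: "D tagged_division_of {s..s}" "\<gamma> fine D"
    using fine_division_exists_real by blast
  have "(\<Sum>(q, K)\<in>D. measure lborel K * g q x) = 0" for x
    using sum_content_null[of s s D "\<lambda>q. g q x"] D by simp
  with AE_linf_norm_less[OF I[OF D]] show ?thesis by simp
qed

text \<open>Bounding one Riemann sum from both sides bounds the increment, with \<open>e\<close> as
  the approximation error. The set \<open>C\<close> localizes the estimate to the points where the
  solution is known to stay near the equilibrium value.\<close>

lemma linf_has_integral_increment_bound:
  fixes r s t :: real
  assumes "linf_has_integral M g I r s" "linf_has_integral M g J r t"
    and "r \<le> s" "s \<le> t" "e > 0"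
    and bound: "\<And>q. q \<in> {s..t} \<Longrightarrow> AE x in M. x \<in> C \<longrightarrow> \<bar>g q x\<bar> \<le> B"
  shows "AE x in M. x \<in> C \<longrightarrow> \<bar>J x - I x\<bar> \<le> B * (t - s) + e"
proof -
  obtain D where D: "D tagged_division_of {s..t}"
    "AE x in M. \<bar>(\<Sum>(q, K)\<in>D. measure lborel K * g q x) - (J x - I x)\<bar> < e"
    using linf_has_integral_increment[OF assms(1-5)] .
  have "fst ` D \<subseteq> {s..t}"
    using tagged_division_ofD(2,3)[OF D(1)] by fastforce
  moreover have "finite (fst ` D)" using D(1) by blast
  ultimately have "AE x in M. \<forall>q\<in>fst ` D. x \<in> C \<longrightarrow> \<bar>g q x\<bar> \<le> B"
    by (subst AE_ball_countable) (auto simp: countable_finite intro!: bound)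
  with D(2) show ?thesis
  proof eventually_elim
    case (elim x)
    show ?case
    proof
      assume "x \<in> C"
      have "- B * (t - s) \<le> (\<Sum>(q, K)\<in>D. measure lborel K * g q x)"
        by (rule Riemann_sum_ge[OF D(1) \<open>s \<le> t\<close>]) (use elim(2) \<open>x \<in> C\<close> in force)
      moreover have "- B * (t - s) \<le> (\<Sum>(q, K)\<in>D. measure lborel K * (- g q x))"
        by (rule Riemann_sum_ge[OF D(1) \<open>s \<le> t\<close>]) (use elim(2) \<open>x \<in> C\<close> in force)
      ultimately show "\<bar>J x - I x\<bar> \<le> B * (t - s) + e"
        using elim(1) by (simp add: sum_negf case_prod_unfold)
    qed
  qed
qed

section \<open>The scalar nonlinearity near its positive equilibrium\<close>

text \<open>Written as \<open>(a - d) * w - a * w / (1 + w * z)\<close>, the nonlinearity has an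
  explicit divided difference. Its sign then follows from continuity, without a mean value
  argument.\<close>

lemma u_rhs_diff:
  assumes "1 + p * z \<noteq> 0" "1 + q * z \<noteq> 0"
  shows "u_rhs a d p z - u_rhs a d q z = (p - q) * (a - d - a / ((1 + p * z) * (1 + q * z)))"
proof -
  have *: "u_rhs a d w z = (a - d) * w - a * w / (1 + w * z)" if "1 + w * z \<noteq> 0" for w
    using that unfolding u_rhs_def by (simp add: field_simps)
  have "a * p / (1 + p * z) - a * q / (1 + q * z) = (p - q) * (a / ((1 + p * z) * (1 + q * z)))"
    using assms by (simp add: divide_simps) (simp add: algebra_simps)
  then show ?thesis
    unfolding *[OF assms(1)] *[OF assms(2)] right_diff_distrib[of "p - q" "a - d"]
    by (simp add: algebra_simps)
qed

text \<open>At \<open>p = q = V\<close>, \<open>z = \<xi>\<close> the divided difference equals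
  \<open>d * (a - d) / a\<close>, which is positive, and \<open>u_rhs\<close> vanishes. Both facts
  persist, in weaker form, in a neighbourhood.\<close>

lemma u_rhs_expanding:
  assumes "0 < d" "d < a" and V: "V * \<xi> = d / (a - d)"
  obtains c \<epsilon> where "c > 0" "\<epsilon> > 0"
    "\<And>p z. \<bar>p - V\<bar> < \<epsilon> \<Longrightarrow> \<bar>z - \<xi>\<bar> < \<epsilon> \<Longrightarrow> \<bar>u_rhs a d p z\<bar> \<le> 1"
    "\<And>p q z. \<bar>p - V\<bar> < \<epsilon> \<Longrightarrow> \<bar>q - V\<bar> < \<epsilon> \<Longrightarrow> \<bar>z - \<xi>\<bar> < \<epsilon> \<Longrightarrow> q \<le> p \<Longrightarrow>
       c * (p - q) \<le> u_rhs a d p z - u_rhs a d q z"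
proof -
  \<comment> \<open>Half of the limiting slope, so that the inequality is strict in the limit and
    survives nearby.\<close>
  define c where "c = d * (a - d) / a / 2"
  have "c > 0" using assms by (simp add: c_def)
  have V1: "1 + V * \<xi> = a / (a - d)" using assms by (simp add: field_simps)
  then have nz: "1 + V * \<xi> \<noteq> 0" using assms by simp
  \<comment> \<open>The variable \<open>w\<close> stands for the triple \<open>(p, q, z)\<close>;
    one neighbourhood filter makes the estimates uniform in all three entries.\<close>
  have lim: "((\<lambda>w. 1 + fst w * snd (snd w)) \<longlongrightarrow> 1 + V * \<xi>) (nhds (V, V, \<xi>))"
            "((\<lambda>w. 1 + fst (snd w) * snd (snd w)) \<longlongrightarrow> 1 + V * \<xi>) (nhds (V, V, \<xi>))"
    by (auto intro!: tendsto_eq_intros filterlim_ident)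
  have ev1: "\<forall>\<^sub>F w in nhds (V, V, \<xi>). 1 + fst w * snd (snd w) \<noteq> 0"
    and ev2: "\<forall>\<^sub>F w in nhds (V, V, \<xi>). 1 + fst (snd w) * snd (snd w) \<noteq> 0"
    using tendsto_imp_eventually_ne[OF lim(1) nz] tendsto_imp_eventually_ne[OF lim(2) nz] by auto
  have "((\<lambda>w. a - d - a / ((1 + fst w * snd (snd w)) * (1 + fst (snd w) * snd (snd w)))) \<longlongrightarrow>
      a - d - a / ((1 + V * \<xi>) * (1 + V * \<xi>))) (nhds (V, V, \<xi>))"
    using nz by (intro tendsto_intros lim) auto
  moreover have "c < a - d - a / ((1 + V * \<xi>) * (1 + V * \<xi>))"
    using assms unfolding V1 c_def by (simp add: field_simps)
  ultimately have ev3: "\<forall>\<^sub>F w in nhds (V, V, \<xi>).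
      c < a - d - a / ((1 + fst w * snd (snd w)) * (1 + fst (snd w) * snd (snd w)))"
    by (rule order_tendstoD)
  have "((\<lambda>w. u_rhs a d (fst w) (snd (snd w))) \<longlongrightarrow> u_rhs a d V \<xi>) (nhds (V, V, \<xi>))"
    unfolding u_rhs_def using nz
    by (auto intro!: tendsto_eq_intros lim filterlim_ident)
  moreover have "u_rhs a d V \<xi> = 0"
    using assms V1 unfolding u_rhs_def by (simp add: mult.assoc)
  ultimately have "((\<lambda>w. u_rhs a d (fst w) (snd (snd w))) \<longlongrightarrow> 0) (nhds (V, V, \<xi>))"
    by simp
  then have "\<forall>\<^sub>F w in nhds (V, V, \<xi>). dist (u_rhs a d (fst w) (snd (snd w))) 0 < 1"
    by (rule tendstoD) simp
  then have "\<forall>\<^sub>F w in nhds (V, V, \<xi>). \<bar>u_rhs a d (fst w) (snd (snd w))\<bar> \<le> 1 \<and>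
      (fst (snd w) \<le> fst w \<longrightarrow> c * (fst w - fst (snd w)) \<le>
        u_rhs a d (fst w) (snd (snd w)) - u_rhs a d (fst (snd w)) (snd (snd w)))"
    using ev1 ev2 ev3
  proof eventually_elim
    case (elim w)
    then show ?case
      by (auto simp: u_rhs_diff mult.commute[of c] intro!: mult_left_mono)
  qed
  then obtain \<epsilon> where "\<epsilon> > 0" and \<epsilon>: "\<And>w. dist w (V, V, \<xi>) < \<epsilon> \<Longrightarrow> \<bar>u_rhs a d (fst w) (snd (snd w))\<bar> \<le> 1 \<and>
      (fst (snd w) \<le> fst w \<longrightarrow> c * (fst w - fst (snd w)) \<le>
        u_rhs a d (fst w) (snd (snd w)) - u_rhs a d (fst (snd w)) (snd (snd w)))"
    unfolding eventually_nhds_metric by blast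
  \<comment> \<open>The product distance is at most the sum of the three coordinate distances,
    whence the radius \<open>\<epsilon> / 3\<close>.\<close>
  have near: "dist (p, q, z) (V, V, \<xi>) < \<epsilon>"
    if "\<bar>p - V\<bar> < \<epsilon> / 3" "\<bar>q - V\<bar> < \<epsilon> / 3" "\<bar>z - \<xi>\<bar> < \<epsilon> / 3" for p q z
  proof -
    have "dist (p, q, z) (V, V, \<xi>) \<le> \<bar>p - V\<bar> + (\<bar>q - V\<bar> + \<bar>z - \<xi>\<bar>)"
      unfolding dist_Pair_Pair dist_real_def
      using sqrt_sum_squares_le_sum_abs[of "q - V" "z - \<xi>"]
        sqrt_sum_squares_le_sum_abs[of "p - V" "sqrt (\<bar>q - V\<bar>\<^sup>2 + \<bar>z - \<xi>\<bar>\<^sup>2)"] by simp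
    then show ?thesis using that by simp
  qed
  show thesis
  proof (rule that[of c "\<epsilon> / 3"])
    show "\<bar>u_rhs a d p z\<bar> \<le> 1" if "\<bar>p - V\<bar> < \<epsilon> / 3" "\<bar>z - \<xi>\<bar> < \<epsilon> / 3" for p z
      using \<epsilon>[OF near[OF that(1) that(1) that(2)]] by simp
    show "c * (p - q) \<le> u_rhs a d p z - u_rhs a d q z"
      if "\<bar>p - V\<bar> < \<epsilon> / 3" "\<bar>q - V\<bar> < \<epsilon> / 3" "\<bar>z - \<xi>\<bar> < \<epsilon> / 3" "q \<le> p" for p q z
      using \<epsilon>[OF near[OF that(1-3)]] that(4) by simp
  qed (use \<open>c > 0\<close> \<open>\<epsilon> > 0\<close> in auto)
qed

section \<open>Instability from two nonnull sets with a common equilibrium value\<close>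

lemma AE_obtains_in:
  assumes "AE x in M. P x" "A \<in> sets M" "emeasure M A \<noteq> 0"
  obtains x where "x \<in> A" "P x"
proof (rule ccontr)
  assume "\<not> thesis"
  with that have "AE x in M. x \<notin> A"
    using assms(1) by (auto elim: eventually_mono)
  then show False
    using AE_iff_null_sets[OF assms(2)] assms(3) by auto
qed

text \<open>Solutions are only determined up to null sets at each time, so the growth of the difference is
  tracked on a time grid and the tags of Riemann sums, which involve countably many times only.\<close>

lemma unstable_of_disjoint_sets:
  assumes "0 < d" "d < a" "V * \<xi> = d / (a - d)" and U: "U \<in> Linf M"
    and A: "A \<in> sets M" "emeasure M A \<noteq> 0" and B: "B \<in> sets M" "emeasure M B \<noteq> 0"
    and "A \<inter> B = {}" and UV: "AE x in M. x \<in> A \<union> B \<longrightarrow> U x = V"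
  shows "unstable M a d \<kappa> U \<xi>"
  unfolding unstable_def
proof
  assume stable: "lyapunov_stable M a d \<kappa> U \<xi>"
  obtain c \<epsilon> where "c > 0" "\<epsilon> > 0"
    and bounded: "\<And>p z. \<bar>p - V\<bar> < \<epsilon> \<Longrightarrow> \<bar>z - \<xi>\<bar> < \<epsilon> \<Longrightarrow> \<bar>u_rhs a d p z\<bar> \<le> 1"
    and expanding: "\<And>p q z. \<bar>p - V\<bar> < \<epsilon> \<Longrightarrow> \<bar>q - V\<bar> < \<epsilon> \<Longrightarrow> \<bar>z - \<xi>\<bar> < \<epsilon> \<Longrightarrow> q \<le> p \<Longrightarrow>
       c * (p - q) \<le> u_rhs a d p z - u_rhs a d q z"
    using u_rhs_expanding[OF assms(1-3)] by metis
  obtain \<delta> where "\<delta> > 0" and \<delta>: "\<And>u\<^sub>0 \<xi>\<^sub>0. u\<^sub>0 \<in> Linf M \<Longrightarrow>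
      X_norm M (\<lambda>x. u\<^sub>0 x - U x) (\<xi>\<^sub>0 - \<xi>) < ereal \<delta> \<Longrightarrow>
      \<exists>u \<zeta>. global_solution M a d \<kappa> u\<^sub>0 \<xi>\<^sub>0 u \<zeta> \<and>
        (\<forall>t\<ge>0. X_norm M (\<lambda>x. u t x - U x) (\<zeta> t - \<xi>) < ereal \<epsilon>)"
    using stable \<open>\<epsilon> > 0\<close> unfolding lyapunov_stable_def by meson
  \<comment> \<open>Raising \<open>U\<close> on \<open>A\<close> only, by less than
    \<open>\<delta>\<close>, creates a gap between \<open>A\<close> and \<open>B\<close> while
    staying in the \<open>\<delta>\<close>-ball.\<close>
  define u\<^sub>0 where "u\<^sub>0 x = U x + \<delta> / 2 * indicator A x" for x
  obtain b where [measurable]: "U \<in> borel_measurable M" and b: "AE x in M. \<bar>U x\<bar> \<le> b"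
    using LinfE[OF U] .
  note [measurable] = A(1)
  have "u\<^sub>0 \<in> Linf M"
  proof (rule LinfI)
    show "u\<^sub>0 \<in> borel_measurable M" unfolding u\<^sub>0_def by measurable
    show "AE x in M. \<bar>u\<^sub>0 x\<bar> \<le> b + \<delta>"
      using b by eventually_elim (use \<open>\<delta> > 0\<close> in \<open>auto simp: u\<^sub>0_def indicator_def\<close>)
  qed
  moreover have "linf_norm M (\<lambda>x. u\<^sub>0 x - U x) \<le> ereal (\<delta> / 2)"
    by (rule linf_norm_le) (use \<open>\<delta> > 0\<close> in \<open>auto simp: u\<^sub>0_def indicator_def\<close>)
  then have "X_norm M (\<lambda>x. u\<^sub>0 x - U x) (\<xi> - \<xi>) < ereal \<delta>"
    using \<open>\<delta> > 0\<close> by (auto simp: X_norm_def intro: le_less_trans)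
  ultimately obtain u \<zeta> where sol: "global_solution M a d \<kappa> u\<^sub>0 \<xi> u \<zeta>"
    and close: "\<And>t. t \<ge> 0 \<Longrightarrow> X_norm M (\<lambda>x. u t x - U x) (\<zeta> t - \<xi>) < ereal \<epsilon>"
    using \<delta> by blast
  have near: "AE x in M. x \<in> A \<union> B \<longrightarrow> \<bar>u t x - V\<bar> < \<epsilon> \<and> \<bar>\<zeta> t - \<xi>\<bar> < \<epsilon>" if "t \<ge> 0" for t
    using AE_X_norm_less[OF close[OF that]] UV by eventually_elim auto
  define g where "g s x = u_rhs a d (u s x) (\<zeta> s)" for s x
  have int: "linf_has_integral M g (\<lambda>x. u t x - u\<^sub>0 x) 0 t" if "t \<ge> 0" for t
  proof -
    \<comment> \<open>The horizon is \<open>t + 1\<close> because \<open>global_solution\<close>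
      speaks of positive horizons only and \<open>t\<close> may be 0.\<close>
    have "solution_on M a d \<kappa> u\<^sub>0 \<xi> (t + 1) u \<zeta>"
      using sol that by (simp add: global_solution_def)
    then show ?thesis
      using that by (simp add: solution_on_def g_def[abs_def])
  qed
  have g_le_1: "AE x in M. x \<in> A \<union> B \<longrightarrow> \<bar>g t x\<bar> \<le> 1" if "t \<ge> 0" for t
    using near[OF that] by eventually_elim (auto simp: g_def intro: bounded)

  \<comment> \<open>The initial gap \<open>2 * w\<close> shrinks to at least \<open>w\<close> after
    errors below \<open>w / 2\<close> at each of two points. Between a grid time and a tag each
    value moves by at most \<open>2 * h\<close>, so the gap at tags is at least
    \<open>w - 4 * h = w / 2\<close>. One step then contributes at least
    \<open>h * c * w / 2 = 4 * e\<close>, and two sum errors below \<open>e\<close> leave a gain of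
    \<open>2 * e\<close>.\<close>
  define w where "w = \<delta> / 4"
  define h where "h = w / 8"
  define e where "e = h * c * w / 8"
  have pos: "w > 0" "h > 0" "e > 0"
    using \<open>\<delta> > 0\<close> \<open>c > 0\<close> by (auto simp: w_def h_def e_def)
  have Lipschitz: "AE x in M. x \<in> A \<union> B \<longrightarrow> \<bar>u t x - u s x\<bar> \<le> 2 * h"
    if "0 \<le> s" "s \<le> t" "t \<le> s + h" for s t
  proof -
    \<comment> \<open>The speed is at most 1 on a time span of at most \<open>h\<close>; the
      approximation error is chosen as another \<open>h\<close>.\<close>
    have "AE x in M. x \<in> A \<union> B \<longrightarrow> \<bar>u t x - u\<^sub>0 x - (u s x - u\<^sub>0 x)\<bar> \<le> 1 * (t - s) + h"
      by (rule linf_has_integral_increment_bound[OF int int]) (use that pos g_le_1 in auto)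
    then show ?thesis
      by eventually_elim (use that in auto)
  qed
  define tk where "tk k = real k * h" for k
  have tk: "tk k \<ge> 0" "tk k \<le> tk (Suc k)" "tk (Suc k) = tk k + h" for k
    using pos by (auto simp: tk_def algebra_simps)
  have "\<forall>k. \<exists>D. D tagged_division_of {tk k..tk (Suc k)} \<and> (AE x in M.
      \<bar>(\<Sum>(q, K)\<in>D. measure lborel K * g q x) - (u (tk (Suc k)) x - u (tk k) x)\<bar> < e)"
    (is "\<forall>k. \<exists>D. ?div k D")
  proof
    fix k
    obtain D where "D tagged_division_of {tk k..tk (Suc k)}" "AE x in M. \<bar>(\<Sum>(q, K)\<in>D.
        measure lborel K * g q x) - (u (tk (Suc k)) x - u\<^sub>0 x - (u (tk k) x - u\<^sub>0 x))\<bar> < e"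
      using linf_has_integral_increment[OF int[OF tk(1)] int[OF tk(1)] tk(1,2) \<open>e > 0\<close>] .
    then show "\<exists>D. ?div k D" by auto
  qed
  from choice[OF this] obtain D where "\<And>k. ?div k (D k)" by blast
  then have D: "\<And>k. D k tagged_division_of {tk k..tk (Suc k)}" and sum_D: "\<And>k. AE x in M.
      \<bar>(\<Sum>(q, K)\<in>D k. measure lborel K * g q x) - (u (tk (Suc k)) x - u (tk k) x)\<bar> < e"
    by blast+
  have tags: "fst ` D k \<subseteq> {tk k..tk (Suc k)}" for k
    using tagged_division_ofD(2,3)[OF D] by fastforce
  have "finite (fst ` D k)" for k using D by blast
  then have "AE x in M. \<forall>q\<in>fst ` D k. x \<in> A \<union> B \<longrightarrow>
      \<bar>u q x - V\<bar> < \<epsilon> \<and> \<bar>\<zeta> q - \<xi>\<bar> < \<epsilon> \<and> \<bar>u q x - u (tk k) x\<bar> \<le> 2 * h" for k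
  proof (subst AE_ball_countable, intro countable_finite, assumption, intro ballI)
    fix q assume "q \<in> fst ` D k"
    then have q: "tk k \<le> q" "q \<le> tk k + h" "0 \<le> q"
      using tags[of k] tk[of k] by auto
    show "AE x in M. x \<in> A \<union> B \<longrightarrow> \<bar>u q x - V\<bar> < \<epsilon> \<and> \<bar>\<zeta> q - \<xi>\<bar> < \<epsilon> \<and> \<bar>u q x - u (tk k) x\<bar> \<le> 2 * h"
      using near[OF q(3)] Lipschitz[OF tk(1) q(1,2)] by eventually_elim auto
  qed
  moreover have "AE x in M. \<bar>u 0 x - u\<^sub>0 x\<bar> < w / 2"
    using linf_has_integral_degenerate[OF int[of 0], of "w / 2"] pos by simp
  \<comment> \<open>All conditions at grid times and tags are gathered into one almost everywhere
    statement, so that one \<open>x\<close> in \<open>A\<close> and one \<open>y\<close> in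
    \<open>B\<close> serve for every step.\<close>
  ultimately have "AE x in M. x \<in> A \<union> B \<longrightarrow> U x = V \<and> \<bar>u 0 x - u\<^sub>0 x\<bar> < w / 2 \<and> (\<forall>k.
      \<bar>u (tk k) x - V\<bar> < \<epsilon> \<and>
      \<bar>(\<Sum>(q, K)\<in>D k. measure lborel K * g q x) - (u (tk (Suc k)) x - u (tk k) x)\<bar> < e \<and>
      (\<forall>q\<in>fst ` D k. \<bar>u q x - V\<bar> < \<epsilon> \<and> \<bar>\<zeta> q - \<xi>\<bar> < \<epsilon> \<and> \<bar>u q x - u (tk k) x\<bar> \<le> 2 * h))"
    (is "AE x in M. x \<in> A \<union> B \<longrightarrow> ?good x")
  proof -
    assume 1: "\<And>k. AE x in M. \<forall>q\<in>fst ` D k. x \<in> A \<union> B \<longrightarrow>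
      \<bar>u q x - V\<bar> < \<epsilon> \<and> \<bar>\<zeta> q - \<xi>\<bar> < \<epsilon> \<and> \<bar>u q x - u (tk k) x\<bar> \<le> 2 * h"
    assume 2: "AE x in M. \<bar>u 0 x - u\<^sub>0 x\<bar> < w / 2"
    have "AE x in M. \<forall>k. x \<in> A \<union> B \<longrightarrow> \<bar>u (tk k) x - V\<bar> < \<epsilon> \<and>
      \<bar>(\<Sum>(q, K)\<in>D k. measure lborel K * g q x) - (u (tk (Suc k)) x - u (tk k) x)\<bar> < e \<and>
      (\<forall>q\<in>fst ` D k. \<bar>u q x - V\<bar> < \<epsilon> \<and> \<bar>\<zeta> q - \<xi>\<bar> < \<epsilon> \<and> \<bar>u q x - u (tk k) x\<bar> \<le> 2 * h)"
    proof (subst AE_all_countable, intro allI)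
      fix k
      show "AE x in M. x \<in> A \<union> B \<longrightarrow> \<bar>u (tk k) x - V\<bar> < \<epsilon> \<and>
        \<bar>(\<Sum>(q, K)\<in>D k. measure lborel K * g q x) - (u (tk (Suc k)) x - u (tk k) x)\<bar> < e \<and>
        (\<forall>q\<in>fst ` D k. \<bar>u q x - V\<bar> < \<epsilon> \<and> \<bar>\<zeta> q - \<xi>\<bar> < \<epsilon> \<and> \<bar>u q x - u (tk k) x\<bar> \<le> 2 * h)"
        using near[OF tk(1)[of k]] sum_D[of k] 1[of k] by eventually_elim blast
    qed
    with 2 UV show ?thesis by eventually_elim blast
  qed
  note good = this
  obtain x where xA: "x \<in> A" and "x \<in> A \<union> B \<longrightarrow> ?good x"
    using AE_obtains_in[OF good A] .
  then have x: "?good x" by blast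
  obtain y where yB: "y \<in> B" and "y \<in> A \<union> B \<longrightarrow> ?good y"
    using AE_obtains_in[OF good B] .
  then have y: "?good y" by blast
  have near_q: "\<bar>u q x - V\<bar> < \<epsilon>" "\<bar>u q y - V\<bar> < \<epsilon>" "\<bar>\<zeta> q - \<xi>\<bar> < \<epsilon>"
      "\<bar>u q x - u (tk k) x\<bar> \<le> 2 * h" "\<bar>u q y - u (tk k) y\<bar> \<le> 2 * h"
    if "q \<in> fst ` D k" for q k
    using x y that by blast+
  have sum_q: "\<bar>(\<Sum>(q, K)\<in>D k. measure lborel K * g q x) - (u (tk (Suc k)) x - u (tk k) x)\<bar> < e"
      "\<bar>(\<Sum>(q, K)\<in>D k. measure lborel K * g q y) - (u (tk (Suc k)) y - u (tk k) y)\<bar> < e" for k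
    using x y by blast+

  \<comment> \<open>Linear growth suffices for the contradiction: the induction hypothesis keeps the
    gap at least \<open>w\<close>, and this alone yields the fixed gain per step.\<close>
  have growth: "u (tk k) x - u (tk k) y \<ge> w + real k * (2 * e)" for k
  proof (induction k)
    case 0
    have "U x = V" "U y = V" "y \<notin> A"
      using x y yB \<open>A \<inter> B = {}\<close> by blast+
    then have "u\<^sub>0 x = V + 2 * w" "u\<^sub>0 y = V"
      using xA by (auto simp: u\<^sub>0_def w_def)
    moreover have "\<bar>u 0 x - u\<^sub>0 x\<bar> < w / 2" "\<bar>u 0 y - u\<^sub>0 y\<bar> < w / 2"
      using x y by blast+
    ultimately have "w \<le> u 0 x - u 0 y" by linarith
    then show ?case by (simp add: tk_def)
  next
    case (Suc k)
    have "c * w / 2 * (tk (Suc k) - tk k) \<le> (\<Sum>(q, K)\<in>D k. measure lborel K * (g q x - g q y))"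
    proof (rule Riemann_sum_ge[OF D tk(2)])
      fix q assume q: "q \<in> fst ` D k"
      have "w \<le> u (tk k) x - u (tk k) y"
        using Suc.IH pos by (smt (verit) mult_nonneg_nonneg of_nat_0_le_iff)
      then have d: "w / 2 \<le> u q x - u q y"
        using near_q(4,5)[OF q] unfolding h_def by linarith
      then have "c * (w / 2) \<le> c * (u q x - u q y)"
        using \<open>c > 0\<close> by (intro mult_left_mono) auto
      also have "\<dots> \<le> g q x - g q y"
        unfolding g_def by (rule expanding) (use near_q[OF q] d pos in auto)
      finally show "c * w / 2 \<le> g q x - g q y" by simp
    qed
    also have "\<dots> = (\<Sum>(q, K)\<in>D k. measure lborel K * g q x) - (\<Sum>(q, K)\<in>D k. measure lborel K * g q y)"
      by (simp add: right_diff_distrib sum_subtractf case_prod_unfold)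
    also have "\<dots> < (u (tk (Suc k)) x - u (tk k) x) - (u (tk (Suc k)) y - u (tk k) y) + 2 * e"
      using sum_q[of k] by linarith
    finally have "4 * e < (u (tk (Suc k)) x - u (tk k) x) - (u (tk (Suc k)) y - u (tk k) y) + 2 * e"
      by (simp add: e_def tk(3) algebra_simps)
    with Suc.IH show ?case by (simp add: algebra_simps)
  qed
  \<comment> \<open>Two values within \<open>\<epsilon>\<close> of \<open>V\<close> differ by less
    than \<open>2 * \<epsilon>\<close>, which the growing gap eventually exceeds.\<close>
  obtain k where "real k * (2 * e) > 2 * \<epsilon>"
    using reals_Archimedean3[of "2 * e"] pos by (metis mult_pos_pos zero_less_numeral)
  moreover have "\<bar>u (tk k) x - V\<bar> < \<epsilon>" "\<bar>u (tk k) y - V\<bar> < \<epsilon>"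
    using x y by blast+
  ultimately show False
    using growth[of k] pos by linarith
qed

section \<open>Splitting a set of positive Lebesgue measure\<close>

text \<open>Choose a radius whose balls have measure below that of \<open>S\<close>. Countably many
  such balls, centred in a dense set, cover \<open>S\<close>, so one of them meets \<open>S\<close>
  in positive measure; it is too small to contain almost all of \<open>S\<close>.\<close>

lemma lebesgue_split_positive_measure:
  fixes S :: "'a::euclidean_space set"
  assumes S: "S \<in> sets lebesgue" "emeasure lebesgue S \<noteq> 0"
  obtains A B where "A \<in> sets lebesgue" "B \<in> sets lebesgue" "A \<subseteq> S" "B \<subseteq> S" "A \<inter> B = {}"
    "emeasure lebesgue A \<noteq> 0" "emeasure lebesgue B \<noteq> 0"
proof -
  obtain r where "r > 0" and small: "\<And>x::'a. emeasure lebesgue (ball x r) < emeasure lebesgue S"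
  proof -
    define V where "V = unit_ball_vol (real DIM('a))"
    have "((\<lambda>r. ennreal (V * r ^ DIM('a))) \<longlongrightarrow> ennreal (V * 0 ^ DIM('a))) (at_right 0)"
      by (intro tendsto_intros)
    moreover have "ennreal (V * 0 ^ DIM('a)) = 0" by (simp add: power_0_left)
    ultimately have "((\<lambda>r. ennreal (V * r ^ DIM('a))) \<longlongrightarrow> 0) (at_right 0)"
      by simp
    moreover have "0 < emeasure lebesgue S" using S by (simp add: zero_less_iff_neq_zero)
    ultimately have "\<forall>\<^sub>F r in at_right 0. ennreal (V * r ^ DIM('a)) < emeasure lebesgue S"
      by (rule order_tendstoD)
    with eventually_at_right_less[of 0]
    have "\<forall>\<^sub>F r in at_right 0. r > 0 \<and> ennreal (V * r ^ DIM('a)) < emeasure lebesgue S"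
      by eventually_elim simp
    from eventually_happens'[OF trivial_limit_at_right_real this]
    obtain r where "r > 0" "ennreal (V * r ^ DIM('a)) < emeasure lebesgue S" by blast
    then show thesis
      by (intro that[of r]) (auto simp: V_def emeasure_ball)
  qed
  obtain Q :: "'a set" where Q: "countable Q" "\<And>X. open X \<Longrightarrow> X \<noteq> {} \<Longrightarrow> \<exists>q\<in>Q. q \<in> X"
    using countable_dense_setE by metis
  have "\<exists>q\<in>Q. x \<in> ball q r" for x
    using Q(2)[of "ball x r"] \<open>r > 0\<close> by (auto simp: dist_commute)
  then have cover: "S = (\<Union>q\<in>Q. S \<inter> ball q r)" by blast
  obtain q where q: "emeasure lebesgue (S \<inter> ball q r) \<noteq> 0"
  proof (rule ccontr)
    assume "\<not> thesis"
    with that S have "\<And>q. S \<inter> ball q r \<in> null_sets lebesgue" by (auto simp: null_sets_def)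
    then have "S \<in> null_sets lebesgue"
      using cover null_sets_UN'[OF Q(1), of "\<lambda>q. S \<inter> ball q r" lebesgue] by simp
    then show False using S by auto
  qed
  have "emeasure lebesgue (S - ball q r) \<noteq> 0"
  proof
    assume *: "emeasure lebesgue (S - ball q r) = 0"
    have "emeasure lebesgue S = emeasure lebesgue (S \<inter> ball q r) + emeasure lebesgue (S - ball q r)"
      using S(1) plus_emeasure[of "S \<inter> ball q r" lebesgue "S - ball q r"]
      by (simp add: Int_Diff_disjoint Int_Diff_Un sets.Int sets.Diff del: emeasure_completion)
    also have "\<dots> \<le> emeasure lebesgue (ball q r)"
      unfolding * add_0_right by (rule emeasure_mono) auto
    finally show False using small[of q] by simp
  qed
  with q S show thesis
    by (intro that[of "S \<inter> ball q r" "S - ball q r"]) auto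
qed

section \<open>Characterization of the nonnegative stationary solutions\<close>

text \<open>Where \<open>U\<close> is nonzero it cancels from the first equation, and the positive
  denominator \<open>1 + U x * \<xi>\<close> can be cleared, which determines \<open>U x\<close>.
  Inserting this into the second equation gives the quadratic for \<open>\<xi>\<close>.\<close>

lemma nonneg_stationary_iff:
  fixes M :: "'a measure" and a d \<kappa> \<xi> :: real
  assumes "0 < d" "d < a" "\<kappa> > 0" and U: "U \<in> Linf M"
    and S: "S\<^sub>1 \<in> sets M" "space M = S\<^sub>1 \<union> S\<^sub>2" "S\<^sub>1 \<inter> S\<^sub>2 = {}"
    and m: "measure M S\<^sub>1 = m" "m > 0"
  shows "nonneg_stationary_with_support S\<^sub>1 S\<^sub>2 M a d \<kappa> U \<xi> \<longleftrightarrow>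
      (AE x in M. U x = (if x \<in> S\<^sub>1 then d / ((a - d) * \<xi>) else 0)) \<and>
      \<xi>\<^sup>2 - \<kappa> * \<xi> + d\<^sup>2 / (a - d)\<^sup>2 * m = 0" (is "?L \<longleftrightarrow> ?formula \<and> ?root")
proof -
  have [measurable]: "U \<in> borel_measurable M" "S\<^sub>1 \<in> sets M"
    using U S by (auto simp: Linf_def)
  have S1_pos: "emeasure M S\<^sub>1 \<noteq> 0"
    using m by (auto simp: measure_def)
  have xi_rhs: "xi_rhs M \<kappa> U \<xi> = 0 \<longleftrightarrow> ?root" if ?formula "\<xi> \<noteq> 0"
  proof -
    have "(LINT x|M. (U x)\<^sup>2) = (LINT x|M. (d / ((a - d) * \<xi>))\<^sup>2 * indicator S\<^sub>1 x)"
      by (rule integral_cong_AE) (use that(1) in \<open>auto elim!: eventually_mono\<close>)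
    also have "\<dots> = (d / ((a - d) * \<xi>))\<^sup>2 * m"
      using S m by simp
    finally have "\<xi>\<^sup>2 * (LINT x|M. (U x)\<^sup>2) = d\<^sup>2 / (a - d)\<^sup>2 * m"
      using that(2) by (simp add: power_divide power_mult_distrib)
    \<comment> \<open>Multiplying by the nonzero \<open>\<xi>\<close> clears the
      \<open>1 / \<xi>\<close> that the integral of the square of \<open>U\<close> brings
      in.\<close>
    then have "xi_rhs M \<kappa> U \<xi> * \<xi> = - (\<xi>\<^sup>2 - \<kappa> * \<xi> + d\<^sup>2 / (a - d)\<^sup>2 * m)"
      unfolding xi_rhs_def by (simp add: algebra_simps power2_eq_square)
    then show ?thesis using that(2) by (metis mult_eq_0_iff neg_equal_0_iff_equal)
  qed
  show ?thesis
  proof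
    assume L: ?L
    have "0 \<le> \<xi>" using L by (simp add: nonneg_stationary_with_support_def)
    have "AE x in M. u_rhs a d (U x) \<xi> = 0" "AE x in M. 0 \<le> U x"
        "AE x in M. x \<in> S\<^sub>1 \<longrightarrow> U x \<noteq> 0"
      using L by (simp_all add: nonneg_stationary_with_support_def stationary_solution_def)
    then have S1: "AE x in M. x \<in> S\<^sub>1 \<longrightarrow> U x * (\<xi> * (a - d)) = d"
    proof eventually_elim
      case (elim x)
      show ?case
      proof (rule impI)
        assume "x \<in> S\<^sub>1"
        with elim have "a * U x * \<xi> / (1 + U x * \<xi>) = d"
          by (simp add: u_rhs_def)
        moreover have "1 + U x * \<xi> > 0"
          using elim(2) \<open>0 \<le> \<xi>\<close> by (simp add: add_pos_nonneg)
        ultimately show "U x * (\<xi> * (a - d)) = d" by (simp add: field_simps)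
      qed
    qed
    \<comment> \<open>At a single point of \<open>S\<^sub>1\<close> the equation already excludes
      \<open>\<xi> = 0\<close>, since \<open>d\<close> is positive.\<close>
    then obtain x where "U x * (\<xi> * (a - d)) = d"
      using AE_obtains_in[OF S1 S(1) S1_pos] by metis
    then have "\<xi> \<noteq> 0" using \<open>0 < d\<close> by auto
    have "AE x in M. x \<in> S\<^sub>2 \<longrightarrow> U x = 0"
      using L by (simp add: nonneg_stationary_with_support_def)
    with S1 AE_space have ?formula
      by eventually_elim (use S \<open>\<xi> \<noteq> 0\<close> \<open>d < a\<close> in \<open>auto simp: field_simps\<close>)
    with xi_rhs \<open>\<xi> \<noteq> 0\<close> L show "?formula \<and> ?root"
      by (simp add: nonneg_stationary_with_support_def stationary_solution_def)
  next
    assume R: "?formula \<and> ?root"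
    \<comment> \<open>For a root this sum equals \<open>\<kappa> * \<xi>\<close>, so every real root
      is positive.\<close>
    have "0 < \<xi>\<^sup>2 + d\<^sup>2 / (a - d)\<^sup>2 * m"
      using assms(1,2) m by (intro add_nonneg_pos) auto
    then have "\<kappa> * \<xi> > 0" using R by linarith
    then have "\<xi> > 0" using \<open>\<kappa> > 0\<close> by (simp add: zero_less_mult_iff)
    have V: "d / ((a - d) * \<xi>) > 0" "d / ((a - d) * \<xi>) * \<xi> = d / (a - d)"
      using \<open>\<xi> > 0\<close> assms(1,2) by (auto simp: field_simps)
    have "1 + d / (a - d) = a / (a - d)" using assms(2) by (simp add: field_simps)
    then have zero: "u_rhs a d (d / ((a - d) * \<xi>)) \<xi> = 0"
      unfolding u_rhs_def mult.assoc V(2) using assms(1,2) by simp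
    have F: "AE x in M. U x = (if x \<in> S\<^sub>1 then d / ((a - d) * \<xi>) else 0)"
      using R by blast
    show ?L
      unfolding nonneg_stationary_with_support_def stationary_solution_def
    proof (intro conjI U)
      show "AE x in M. u_rhs a d (U x) \<xi> = 0"
        using F by eventually_elim (use zero in \<open>auto simp: u_rhs_def\<close>)
      show "xi_rhs M \<kappa> U \<xi> = 0"
        using xi_rhs R \<open>\<xi> > 0\<close> by simp
      show "AE x in M. 0 \<le> U x"
        using F by eventually_elim (use V in auto)
      show "AE x in M. x \<in> S\<^sub>1 \<longrightarrow> U x \<noteq> 0"
        using F by eventually_elim (use V in auto)
      show "AE x in M. x \<in> S\<^sub>2 \<longrightarrow> U x = 0"
        using F by eventually_elim (use S(3) in auto)
    qed (use \<open>\<xi> > 0\<close> in simp)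
  qed
qed

section \<open>Existence, explicit form and instability on \<Omega>\<close>

theorem theorem2p5:
  fixes \<Omega> \<Omega>\<^sub>1 \<Omega>\<^sub>2 :: "(real ^ 'n) set" and a d \<kappa>\<^sub>0 :: real
  assumes "bounded \<Omega>" and "\<Omega> \<in> sets lebesgue" and "measure lebesgue \<Omega> = 1"
    and "a > 0" and "d > 0" and "\<kappa>\<^sub>0 > 0"
    and "\<Omega>\<^sub>1 \<in> sets lebesgue" and "\<Omega>\<^sub>2 \<in> sets lebesgue"
    and "\<Omega> = \<Omega>\<^sub>1 \<union> \<Omega>\<^sub>2" and "\<Omega>\<^sub>1 \<inter> \<Omega>\<^sub>2 = {}"
    and "measure lebesgue \<Omega>\<^sub>1 > 0"
    and "a > d"
    and "\<kappa>\<^sub>0\<^sup>2 > 4 * (d / (a - d))\<^sup>2 * measure lebesgue \<Omega>\<^sub>1"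
  shows
    "(\<exists>U \<xi>. nonneg_stationary_with_support \<Omega>\<^sub>1 \<Omega>\<^sub>2 (lebesgue_on \<Omega>) a d \<kappa>\<^sub>0 U \<xi>) \<and>
     (\<forall>U\<in>Linf (lebesgue_on \<Omega>). \<forall>\<xi>.
        nonneg_stationary_with_support \<Omega>\<^sub>1 \<Omega>\<^sub>2 (lebesgue_on \<Omega>) a d \<kappa>\<^sub>0 U \<xi> \<longleftrightarrow>
          (AE x in lebesgue_on \<Omega>. U x = (if x \<in> \<Omega>\<^sub>1 then d / ((a - d) * \<xi>) else 0)) \<and>
          \<xi>\<^sup>2 - \<kappa>\<^sub>0 * \<xi> + d\<^sup>2 / (a - d)\<^sup>2 * measure lebesgue \<Omega>\<^sub>1 = 0) \<and>
     (\<forall>U \<xi>. nonneg_stationary_with_support \<Omega>\<^sub>1 \<Omega>\<^sub>2 (lebesgue_on \<Omega>) a d \<kappa>\<^sub>0 U \<xi> \<longrightarrow>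
        unstable (lebesgue_on \<Omega>) a d \<kappa>\<^sub>0 U \<xi>)"
proof -
  let ?M = "lebesgue_on \<Omega>"
  define m where "m = measure lebesgue \<Omega>\<^sub>1"
  note \<open>\<Omega> \<in> sets lebesgue\<close>[simp]
  have S: "\<Omega>\<^sub>1 \<in> sets ?M" "space ?M = \<Omega>\<^sub>1 \<union> \<Omega>\<^sub>2" "\<Omega>\<^sub>1 \<inter> \<Omega>\<^sub>2 = {}"
    using assms by (auto simp: sets_restrict_space_iff space_restrict_space)
  have m: "measure ?M \<Omega>\<^sub>1 = m" "m > 0"
    using assms by (auto simp: m_def measure_restrict_space)
  note iff = nonneg_stationary_iff[OF \<open>d > 0\<close> \<open>a > d\<close> \<open>\<kappa>\<^sub>0 > 0\<close> _ S m]

  have "\<exists>U \<xi>. nonneg_stationary_with_support \<Omega>\<^sub>1 \<Omega>\<^sub>2 ?M a d \<kappa>\<^sub>0 U \<xi>"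
  proof -
    \<comment> \<open>\<open>\<rho>\<close> is the root of the discriminant, whose positivity is the
      assumption on \<open>\<kappa>\<^sub>0\<close>; \<open>\<xi>\<close> is then the larger root of
      the quadratic.\<close>
    define \<rho> where "\<rho> = sqrt (\<kappa>\<^sub>0\<^sup>2 - 4 * (d / (a - d))\<^sup>2 * m)"
    define \<xi> where "\<xi> = (\<kappa>\<^sub>0 + \<rho>) / 2"
    define U where "U x = (if x \<in> \<Omega>\<^sub>1 then d / ((a - d) * \<xi>) else 0)" for x
    have "(2 * \<xi> - \<kappa>\<^sub>0)\<^sup>2 = \<rho>\<^sup>2" by (simp add: \<xi>_def field_simps)
    also have "\<dots> = \<kappa>\<^sub>0\<^sup>2 - 4 * (d / (a - d))\<^sup>2 * m"
      using assms by (simp add: \<rho>_def m_def)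
    finally have "\<xi>\<^sup>2 - \<kappa>\<^sub>0 * \<xi> + (d / (a - d))\<^sup>2 * m = 0"
      unfolding power2_diff[of "2 * \<xi>"] by (simp add: power_mult_distrib mult.commute[of \<kappa>\<^sub>0])
    then have "\<xi>\<^sup>2 - \<kappa>\<^sub>0 * \<xi> + d\<^sup>2 / (a - d)\<^sup>2 * m = 0"
      unfolding power_divide .
    moreover have "U \<in> Linf ?M"
    proof (rule LinfI)
      show "U \<in> borel_measurable ?M"
        unfolding U_def using S(1) by measurable
      show "AE x in ?M. \<bar>U x\<bar> \<le> \<bar>d / ((a - d) * \<xi>)\<bar>"
        by (simp add: U_def)
    qed
    ultimately have "nonneg_stationary_with_support \<Omega>\<^sub>1 \<Omega>\<^sub>2 ?M a d \<kappa>\<^sub>0 U \<xi>"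
      by (subst iff) (auto simp: U_def)
    then show ?thesis by blast
  qed
  moreover have "unstable ?M a d \<kappa>\<^sub>0 U \<xi>"
    if stat: "nonneg_stationary_with_support \<Omega>\<^sub>1 \<Omega>\<^sub>2 ?M a d \<kappa>\<^sub>0 U \<xi>" for U \<xi>
  proof -
    have U: "U \<in> Linf ?M"
      using stat by (simp add: nonneg_stationary_with_support_def stationary_solution_def)
    have F: "AE x in ?M. U x = (if x \<in> \<Omega>\<^sub>1 then d / ((a - d) * \<xi>) else 0)"
      and root: "\<xi>\<^sup>2 - \<kappa>\<^sub>0 * \<xi> + d\<^sup>2 / (a - d)\<^sup>2 * m = 0"
      using stat iff[OF U] by auto
    \<comment> \<open>The constant term of the quadratic is positive, so 0 is not a root.\<close>
    have "\<xi> \<noteq> 0" using root m assms by auto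
    have "emeasure lebesgue \<Omega>\<^sub>1 \<noteq> 0"
      using assms by (auto simp: measure_def)
    then obtain A B where AB: "A \<in> sets lebesgue" "B \<in> sets lebesgue" "A \<subseteq> \<Omega>\<^sub>1" "B \<subseteq> \<Omega>\<^sub>1"
        "A \<inter> B = {}" "emeasure lebesgue A \<noteq> 0" "emeasure lebesgue B \<noteq> 0"
      using lebesgue_split_positive_measure[OF \<open>\<Omega>\<^sub>1 \<in> sets lebesgue\<close>] by metis
    have sub: "A \<subseteq> \<Omega>" "B \<subseteq> \<Omega>" using AB assms by auto
    show ?thesis
    proof (rule unstable_of_disjoint_sets[where V = "d / ((a - d) * \<xi>)" and A = A and B = B])
      show "d / ((a - d) * \<xi>) * \<xi> = d / (a - d)" using \<open>\<xi> \<noteq> 0\<close> by simp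
      show "A \<in> sets ?M" "B \<in> sets ?M" using AB sub by (auto simp: sets_restrict_space_iff)
      show "emeasure ?M A \<noteq> 0" "emeasure ?M B \<noteq> 0"
        using AB sub by (simp_all add: emeasure_restrict_space del: emeasure_completion)
      show "AE x in ?M. x \<in> A \<union> B \<longrightarrow> U x = d / ((a - d) * \<xi>)"
        using F by eventually_elim (use AB in auto)
    qed (use assms U AB in auto)
  qed
  ultimately show ?thesis
    using iff unfolding m_def by blast
qed

end
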